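(* Let $G=(V,E,\omega,\mu)$ be a finite weighted undirected graph with $V=\{1,\dots,n\}$ and $\sum_{j\sim i}\omega_{ij}<\mu_i$ for every $i\in V$, and let $d\ge1$. Consider the evolution equation $$\frac{\partial X_t}{\partial t}=P_{\mu}\big(\mathrm{Norm}(X_t)\big),\qquad t\ge 0,$$ for differentiable curves $(X_t)_{t\ge0}$ in $\mathbb{R}^{n\times d}$ along which $\mathrm{Norm}(X_t)$ is defined (i.e. $X_t(i)\neq 0$ for all $i\in V$ and $t\ge 0$). (1) There exists a constant $C_1>0$ such that every such solution satisfies, for all $t\ge 0$, $$\int_{G}\vert \nabla_{\mu} X_t\vert^2\,d\mu \;\leq\;\left(C_1t +\sqrt{\int_{G}\vert \nabla_{\mu}X_0\vert^2\,d\mu}\right)^2 .$$ (2) Suppose moreover that a solution satisfies a power-law lower bound: there are constants $C_2>0$ and $q\in\mathbb{R}$ with $$C_2\, t^{q}\;\leq\; \int_{G}\vert \nabla_{\mu} X_t\vert^2\,d\mu\qquad\text{for all } t>0 .$$ Then there is a constant $C>0$ such that for all $t>0$, $$\frac{1}{\int_{G}\vert \nabla_{\mu} X_t\vert^2\,d\mu }\;\frac{\partial}{\partial t}\int_{G}\vert \nabla_{\mu} X_t\vert^2\,d\mu \;\leq\; C\,\frac{1}{t^{q/2}}.$$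
   Context: A weighted undirected graph $G=(V,E,\omega,\mu)$ consists of a vertex set $V$ (here $V=[n]=\{1,\dots,n\}$), an edge set $E$ (undirected, no loops; write $i\sim j$ if $i$ and $j$ are joined by an edge), a symmetric edge weight $\omega_{ij}=\omega_{ji}>0$ for $i\sim j$, and a vertex measure $\mu$ with $\mu_i=\mu(i)>0$ for every $i\in V$. A matrix $X\in\mathbb{R}^{n\times d}$ is identified with the function $X:V\to\mathbb{R}^d$ whose value $X(i)$ is the $i$-th row. The weighted Laplacian is $$\Delta_{\mu}X(i)=\sum_{j\sim i}\frac{\omega_{ij}}{\mu_i}\,(X(j)-X(i)).$$ Under the assumption $\sum_{j\sim i}\omega_{ij}<\mu_i$ for all $i$, the aggregation operator is $P_\mu=\Delta_\mu+I_n$, with $I_n$ the identity, i.e. $P_\mu X=X+\Delta_\mu X$. The squared gradient is the real-valued function $$\vert\nabla_{\mu}X\vert^2(i)=\sum_{j\sim i}\frac{\omega_{ij}}{\mu_i}\,\vert X(j)-X(i)\vert^2 ,$$ where $\vert\cdot\vert$ is the Euclidean norm on $\mathbb{R}^d$. For a function $f$ on $V$, $\int_G f\,d\mu=\sum_{i\in V} f(i)\mu_i$. $\mathrm{Norm}$ denotes row-wise normalization onto the unit sphere: $\mathrm{Norm}(X)(i)=X(i)/\vert X(i)\vert$ for each $i\in V$ (defined when all $X(i)\neq0$). *)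

theory Defs
  imports "HOL-Analysis.Analysis"
begin

text \<open>The vertex set is the whole finite type \<open>'v\<close>.  Edges form a symmetric, irreflexive
  relation; values of \<open>edge_weight\<close> on non-adjacent pairs are never used.\<close>

record 'v wgraph =
  edge_rel :: "('v \<times> 'v) set"
  edge_weight :: "'v \<Rightarrow> 'v \<Rightarrow> real"
  vertex_measure :: "'v \<Rightarrow> real"

definition nbhd :: "'v wgraph \<Rightarrow> 'v \<Rightarrow> 'v set" where
  "nbhd G i = {j. (i, j) \<in> edge_rel G}"

definition weighted_graph :: "'v::finite wgraph \<Rightarrow> bool" where
  "weighted_graph G \<longleftrightarrow>
     sym (edge_rel G) \<and> irrefl (edge_rel G) \<and>
     (\<forall>i j. (i, j) \<in> edge_rel G \<longrightarrow>
        edge_weight G i j = edge_weight G j i \<and> 0 < edge_weight G i j) \<and>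
     (\<forall>i. 0 < vertex_measure G i)"

text \<open>A matrix in \<open>real ^ 'd ^ 'v\<close> is a function on vertices: row \<open>i\<close> is \<open>X $ i :: real ^ 'd\<close>.\<close>

definition laplacian :: "'v::finite wgraph \<Rightarrow> real ^ 'd ^ 'v \<Rightarrow> real ^ 'd ^ 'v" where
  "laplacian G X =
     (\<chi> i. \<Sum>j\<in>nbhd G i. (edge_weight G i j / vertex_measure G i) *\<^sub>R (X $ j - X $ i))"

definition aggregation :: "'v::finite wgraph \<Rightarrow> real ^ 'd ^ 'v \<Rightarrow> real ^ 'd ^ 'v" where
  "aggregation G X = laplacian G X + X"

definition sq_gradient :: "'v::finite wgraph \<Rightarrow> real ^ 'd ^ 'v \<Rightarrow> 'v \<Rightarrow> real" where
  "sq_gradient G X i =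
     (\<Sum>j\<in>nbhd G i. edge_weight G i j / vertex_measure G i * (norm (X $ j - X $ i))\<^sup>2)"

definition graph_integral :: "'v::finite wgraph \<Rightarrow> ('v \<Rightarrow> real) \<Rightarrow> real" where
  "graph_integral G f = (\<Sum>i\<in>UNIV. f i * vertex_measure G i)"

definition row_normalize :: "real ^ 'd ^ 'v \<Rightarrow> real ^ 'd ^ 'v" where
  "row_normalize X = (\<chi> i. (1 / norm (X $ i)) *\<^sub>R X $ i)"

text \<open>Only the values of the curve on \<open>{0..}\<close> matter; the derivative at \<open>0\<close> is one-sided.\<close>

definition normalized_flow_solution ::
    "'v::finite wgraph \<Rightarrow> (real \<Rightarrow> real ^ 'd ^ 'v) \<Rightarrow> bool" where
  "normalized_flow_solution G X \<longleftrightarrow>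
     (\<forall>t\<ge>0. (\<forall>i. X t $ i \<noteq> 0) \<and>
        (X has_vector_derivative aggregation G (row_normalize (X t))) (at t within {0..}))"

end

theory Submission
  imports Defs
begin

text \<open>Weighting each difference across an edge by the square root of the edge weight gives a linear
  map \<open>D\<close> whose squared norm is the Dirichlet energy.  Rows of \<open>Norm X\<close> are unit vectors, so the
  velocity of the flow, and hence of the curve \<open>D X\<close>, has norm at most some constant \<open>C\<close>.
  The mean value inequality for \<open>D X\<close> gives (1); the derivative
  \<open>2 \<langle>D X, (D X)'\<rangle> \<le> 2 C |D X|\<close> of the energy gives (2).\<close>

text \<open>Indexing by ordered pairs lets each undirected edge occur twice, once from each
  endpoint, exactly as in the double sum over vertices and their neighbours.\<close>

definition edge_difference :: "'v::finite wgraph \<Rightarrow> real ^ 'd ^ 'v \<Rightarrow> real ^ 'd ^ ('v \<times> 'v)" where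
  "edge_difference G X = (\<chi> e. if snd e \<in> nbhd G (fst e)
     then sqrt (edge_weight G (fst e) (snd e)) *\<^sub>R (X $ snd e - X $ fst e) else 0)"

lemma bounded_linear_edge_difference:
  "bounded_linear (edge_difference G :: real ^ 'd::finite ^ 'v::finite \<Rightarrow> _)"
  unfolding linear_conv_bounded_linear[symmetric]
  by (rule linearI) (auto simp: edge_difference_def vec_eq_iff algebra_simps)

lemma linear_aggregation: "linear (aggregation G :: real ^ 'd::finite ^ 'v::finite \<Rightarrow> _)"
  by (rule linearI)
    (auto simp: aggregation_def laplacian_def vec_eq_iff algebra_simps sum.distrib
      sum_subtractf sum_distrib_left)

text \<open>The measure in the integral cancels the denominator \<mu>(i) in the squared gradient,
  and nonnegative edge weights are the squares of their roots.\<close>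

lemma dirichlet_energy_eq:
  fixes X :: "real ^ 'd::finite ^ 'v::finite"
  assumes "weighted_graph G"
  shows "graph_integral G (sq_gradient G X) = (norm (edge_difference G X))\<^sup>2"
proof -
  have \<mu>: "vertex_measure G i > 0" for i
    using assms by (auto simp: weighted_graph_def)
  have w: "edge_weight G i j \<ge> 0" if "j \<in> nbhd G i" for i j
    using assms that by (auto simp: weighted_graph_def nbhd_def less_imp_le)
  have "graph_integral G (sq_gradient G X)
      = (\<Sum>i\<in>UNIV. \<Sum>j\<in>nbhd G i. edge_weight G i j * (norm (X $ j - X $ i))\<^sup>2)"
    unfolding graph_integral_def sq_gradient_def sum_distrib_right
    using \<mu> by (intro sum.cong refl) (simp add: less_imp_neq[symmetric])
  also have "\<dots> = (\<Sum>i\<in>UNIV. \<Sum>j\<in>UNIV. (norm (edge_difference G X $ (i, j)))\<^sup>2)"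
    by (intro sum.cong refl sum.mono_neutral_cong_left)
      (auto simp: edge_difference_def w power_mult_distrib)
  also have "\<dots> = (\<Sum>e\<in>UNIV. (norm (edge_difference G X $ e))\<^sup>2)"
    by (simp add: sum.cartesian_product)
  also have "\<dots> = (norm (edge_difference G X))\<^sup>2"
    by (simp add: norm_vec_def L2_set_def sum_nonneg)
  finally show ?thesis .
qed

lemma norm_row_normalize_le:
  "norm (row_normalize X :: real ^ 'd::finite ^ 'v::finite) \<le> real CARD('v)"
proof -
  have "norm (row_normalize X) \<le> (\<Sum>i\<in>UNIV. norm (row_normalize X $ i))"
    unfolding norm_vec_def by (rule L2_set_le_sum) simp
  \<comment> \<open>A zero row also satisfies this bound: division by zero gives 0, so such a row is
    sent to 0. The estimate therefore holds for every matrix.\<close>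
  also have "\<dots> \<le> (\<Sum>i\<in>(UNIV :: 'v set). 1)"
    by (intro sum_mono) (simp add: row_normalize_def)
  finally show ?thesis
    by simp
qed

text \<open>A linear map between finite-dimensional spaces is bounded, and normalized matrices form
  a bounded set. The bound does not depend on \<open>X\<close>, so one constant serves all solutions
  and all times.\<close>

lemma edge_difference_velocity_bounded:
  fixes G :: "'v::finite wgraph"
  obtains C where "C > 0"
    "\<And>X :: real ^ 'd::finite ^ 'v.
       norm (edge_difference G (aggregation G (row_normalize X))) \<le> C"
proof -
  have "bounded_linear (\<lambda>X :: real ^ 'd ^ 'v. edge_difference G (aggregation G X))"
    using bounded_linear_compose[OF bounded_linear_edge_difference]
      linear_aggregation linear_conv_bounded_linear by blast
  then obtain K where K: "K > 0"
    "\<And>X :: real ^ 'd ^ 'v. norm (edge_difference G (aggregation G X)) \<le> norm X * K"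
    using bounded_linear.pos_bounded by blast
  show ?thesis
  proof (rule that[of "real CARD('v) * K"])
    show "norm (edge_difference G (aggregation G (row_normalize X))) \<le> real CARD('v) * K"
      for X :: "real ^ 'd ^ 'v"
      using order_trans[OF K(2) mult_right_mono[OF norm_row_normalize_le]] K(1) by simp
  qed (use K(1) in simp)
qed

lemma edge_difference_solution_derivative:
  fixes X :: "real \<Rightarrow> real ^ 'd::finite ^ 'v::finite"
  assumes "normalized_flow_solution G X" "t \<ge> 0"
  shows "((\<lambda>s. edge_difference G (X s)) has_vector_derivative
           edge_difference G (aggregation G (row_normalize (X t)))) (at t within {0..})"
proof (rule bounded_linear.has_vector_derivative[OF bounded_linear_edge_difference])
  show "(X has_vector_derivative aggregation G (row_normalize (X t))) (at t within {0..})"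
    using assms by (simp add: normalized_flow_solution_def)
qed

lemma norm_le_of_bounded_velocity:
  fixes f :: "real \<Rightarrow> 'a::real_normed_vector"
  assumes "\<And>s. s \<ge> 0 \<Longrightarrow> (f has_vector_derivative f' s) (at s within {0..})"
    and "\<And>s. norm (f' s) \<le> C" and "t \<ge> 0"
  shows "norm (f t) \<le> C * t + norm (f 0)"
proof -
  have "norm (f t - f 0) \<le> C * norm (t - 0)"
  proof (rule differentiable_bound[where S = "{0..}" and f' = "\<lambda>s h. h *\<^sub>R f' s"])
    \<comment> \<open>The derivative as a linear map scales the velocity vector, so its operator
      norm is at most the length of that vector.\<close>
    show "onorm (\<lambda>h. h *\<^sub>R f' s) \<le> C" for s
      using mult_left_mono[OF assms(2)[of s]]
      by (intro onorm_le) (simp add: mult.commute[of C])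
  qed (use assms in \<open>auto simp: has_vector_derivative_def\<close>)
  then show ?thesis
    using norm_triangle_sub[of "f t" "f 0"] \<open>t \<ge> 0\<close> by simp
qed

lemma logarithmic_derivative_norm_sq_le:
  fixes f :: "real \<Rightarrow> 'a::real_inner"
  assumes "(f has_vector_derivative v) (at t)" and "norm v \<le> C"
    and "0 < m" "m \<le> norm (f t)"
  shows "1 / (norm (f t))\<^sup>2 * deriv (\<lambda>s. (norm (f s))\<^sup>2) t \<le> 2 * C / m"
proof -
  have "((\<lambda>s. f s \<bullet> f s) has_vector_derivative (f t \<bullet> v + v \<bullet> f t)) (at t)"
    by (rule bounded_bilinear.has_vector_derivative[OF bounded_bilinear_inner assms(1) assms(1)])
  then have "((\<lambda>s. (norm (f s))\<^sup>2) has_real_derivative 2 * (f t \<bullet> v)) (at t)"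
    by (simp add: power2_norm_eq_inner has_real_derivative_iff_has_vector_derivative inner_commute)
  then have "deriv (\<lambda>s. (norm (f s))\<^sup>2) t = 2 * (f t \<bullet> v)"
    by (rule DERIV_imp_deriv)
  also have "f t \<bullet> v \<le> norm (f t) * C"
    using norm_cauchy_schwarz[of "f t" v] mult_left_mono[OF assms(2) norm_ge_zero[of "f t"]]
    by linarith
  finally have "1 / (norm (f t))\<^sup>2 * deriv (\<lambda>s. (norm (f s))\<^sup>2) t
      \<le> 1 / (norm (f t))\<^sup>2 * (2 * (norm (f t) * C))"
    by (intro mult_left_mono) simp_all
  \<comment> \<open>Cauchy-Schwarz contributes only one factor \<open>norm (f t)\<close> against two
    in the denominator; the remaining one is controlled by \<open>m\<close>.\<close>
  also have "\<dots> = 2 * C / norm (f t)"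
    using assms(3,4) by (simp add: power2_eq_square)
  also have "\<dots> \<le> 2 * C / m"
    using assms(3,4) order_trans[OF norm_ge_zero assms(2)]
    by (intro divide_left_mono mult_pos_pos) linarith+
  finally show ?thesis .
qed

theorem theorem5p1:
  fixes G :: "'v::finite wgraph"
  assumes "weighted_graph G"
    and "\<And>i. (\<Sum>j\<in>nbhd G i. edge_weight G i j) < vertex_measure G i"
  shows "(\<exists>C1>0. \<forall>X :: real \<Rightarrow> real ^ 'd::finite ^ 'v.
            normalized_flow_solution G X \<longrightarrow>
            (\<forall>t\<ge>0. graph_integral G (sq_gradient G (X t))
               \<le> (C1 * t + sqrt (graph_integral G (sq_gradient G (X 0))))\<^sup>2))
       \<and> (\<forall>(X :: real \<Rightarrow> real ^ 'd ^ 'v) C2 q.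
            normalized_flow_solution G X \<longrightarrow> 0 < C2 \<longrightarrow>
            (\<forall>t>0. C2 * t powr q \<le> graph_integral G (sq_gradient G (X t))) \<longrightarrow>
            (\<exists>C>0. \<forall>t>0.
               1 / graph_integral G (sq_gradient G (X t))
                 * deriv (\<lambda>s. graph_integral G (sq_gradient G (X s))) t
               \<le> C * (1 / t powr (q / 2))))"
proof -
  let ?D = "edge_difference G"
  note energy = dirichlet_energy_eq[OF assms(1)]
  obtain C where C: "C > 0"
    "\<And>X :: real ^ 'd ^ 'v. norm (?D (aggregation G (row_normalize X))) \<le> C"
    using edge_difference_velocity_bounded by blast
  have "graph_integral G (sq_gradient G (X t))
      \<le> (C * t + sqrt (graph_integral G (sq_gradient G (X 0))))\<^sup>2"
    if "normalized_flow_solution G X" "t \<ge> 0" for X :: "real \<Rightarrow> real ^ 'd ^ 'v" and t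
    \<comment> \<open>The square root of the energy is the norm of \<open>?D (X t)\<close>, so
      squaring the linear growth bound gives (1).\<close>
    using norm_le_of_bounded_velocity[OF edge_difference_solution_derivative[OF that(1)] C(2) that(2)]
    by (simp add: energy power_mono)
  moreover have "\<exists>C'>0. \<forall>t>0.
      1 / graph_integral G (sq_gradient G (X t))
        * deriv (\<lambda>s. graph_integral G (sq_gradient G (X s))) t \<le> C' * (1 / t powr (q / 2))"
    if sol: "normalized_flow_solution G X" and "0 < C2"
      and lower: "\<forall>t>0. C2 * t powr q \<le> graph_integral G (sq_gradient G (X t))"
    for X :: "real \<Rightarrow> real ^ 'd ^ 'v" and C2 q
  proof (intro exI conjI allI impI)
    \<comment> \<open>This is the constant in \<open>2 * C / m\<close> for
      \<open>m = sqrt C2 * t powr (q / 2)\<close>, once the power of \<open>t\<close> is split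
      off.\<close>
    show "2 * C / sqrt C2 > 0"
      using C(1) \<open>0 < C2\<close> by simp
    fix t :: real
    assume "t > 0"
    \<comment> \<open>Away from 0 the one-sided derivative is two-sided, as \<open>deriv\<close>
      requires.\<close>
    then have "at t within {0..} = at t"
      by (intro at_within_interior) simp
    then have deriv: "((\<lambda>s. ?D (X s)) has_vector_derivative
        ?D (aggregation G (row_normalize (X t)))) (at t)"
      using edge_difference_solution_derivative[OF sol, of t] \<open>t > 0\<close> by simp
    \<comment> \<open>Taking square roots turns the lower bound on the energy into one on the norm,
      which halves the exponent.\<close>
    have "(t powr (q / 2))\<^sup>2 = t powr q"
      by (simp add: power2_eq_square flip: powr_add)
    then have "(sqrt C2 * t powr (q / 2))\<^sup>2 = C2 * t powr q"
      using \<open>0 < C2\<close> by (simp add: power_mult_distrib)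
    also have "\<dots> \<le> (norm (?D (X t)))\<^sup>2"
      using lower \<open>t > 0\<close> unfolding energy by blast
    finally have bound: "sqrt C2 * t powr (q / 2) \<le> norm (?D (X t))"
      by (rule power2_le_imp_le) simp
    have "0 < sqrt C2 * t powr (q / 2)"
      using \<open>0 < C2\<close> \<open>t > 0\<close> by simp
    from logarithmic_derivative_norm_sq_le[OF deriv C(2) this bound]
    show "1 / graph_integral G (sq_gradient G (X t))
        * deriv (\<lambda>s. graph_integral G (sq_gradient G (X s))) t
      \<le> 2 * C / sqrt C2 * (1 / t powr (q / 2))"
      unfolding energy by simp
  qed
  ultimately show ?thesis
    using C(1) by blast
qed

end
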